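(* Consider an instance of the Capacitated Delivery Problem with Parking (CDPP) with loading times $f_j=f\cdot|\sigma_j|$ for some constant $f\ge0$. There exists an optimal solution of the CDPP in which, for all $i\in\Pi\cap C$, $y_{ij}=0$ for all $\sigma_j\in\{\sigma_j\in J_i:\ |\sigma_j|\ge2\}$.
   Context: CDPP data. $C$ is a finite set of $n\ge1$ customers, each requiring one package. $\Pi$ is a finite set consisting of the depot $0$ (with $0\notin C$) and the parking locations $\Pi\setminus\{0\}\neq\emptyset$; parking locations may or may not be customers. $p_i\ge0$ is the search time for parking at $i\in\Pi\setminus\{0\}$. $S$ is the set of customer service sets $\sigma_j$: the nonempty subsets of $C$ satisfying the delivery person's capacity restrictions (an upper bound on the number of packages $|\sigma_j|\le q$, and/or on total weight $\sum_{i\in\sigma_j}\psi_i\le\Psi$, and/or on total volume $\sum_{i\in\sigma_j}v_i\le V$, with nonnegative weights and volumes); every singleton $\{i\}$, $i\in C$, satisfies the capacity restrictions. For $i\in C$, $J_i=\{\sigma_j\in S: i\in\sigma_j\}$. Times. $D(i,k)\ge0$ is the driving time from $i$ to $k$ ($i,k\in\Pi$) and $W(i,k)\ge0$ is the walking time from $i$ to $k$ ($i,k\in C\cup\Pi\setminus\{0\}$), with $D(i,i)=W(i,i)=0$; both satisfy the triangle inequality. Set $d_{ik}=D(i,k)+p_k$ for $k\neq0$, $i\ne k$, and $d_{i0}=D(i,0)$. For $i\in\Pi\setminus\{0\}$ and $\sigma_j\in S$, $w_{ij}$ is the minimum over orderings $(c_1,\dots,c_m)$ of $\sigma_j$ of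 $W(i,c_1)+W(c_1,c_2)+\cdots+W(c_{m-1},c_m)+W(c_m,i)$. $f_j$ is the time to load the packages of $\sigma_j$. CDPP. Minimize $$\sum_{i\in\Pi}\sum_{k\in\Pi\setminus\{i\}}x_{ik}d_{ik}+\sum_{i\in\Pi\setminus\{0\}}\sum_{\sigma_j\in S}y_{ij}(w_{ij}+f_j)$$ subject to (1) $\sum_{i\in\Pi\setminus\{0\}}x_{0i}=1$ and $\sum_{i\in\Pi\setminus\{0\}}x_{i0}=1$; (2) $\sum_{k\in\Pi\setminus\{0\}}\sum_{\sigma_j\in J_i}y_{kj}=1$ for all $i\in C$; (3) $\sum_{k\in\Pi\setminus\{i\}}x_{ki}=\sum_{k\in\Pi\setminus\{i\}}x_{ik}$ for all $i\in\Pi\setminus\{0\}$; (4) $y_{ij}\le\sum_{k\in\Pi\setminus\{i\}}x_{ki}$ for all $i\in\Pi\setminus\{0\}$, $\sigma_j\in S$; (5) $\sum_{i\in\Pi\setminus\{0\}}v_{0i}=n$; (6) $v_{ik}\le n\,x_{ik}$ for all $i\in\Pi$, $k\in\Pi\setminus\{0\}$, $i\ne k$; (7) $\sum_{k\in\Pi\setminus\{i\}}v_{ki}-\sum_{k\in\Pi\setminus\{0,i\}}v_{ik}=\sum_{\sigma_j\in S}|\sigma_j|y_{ij}$ for all $i\in\Pi\setminus\{0\}$; (8) $x_{ik}\in\{0,1\}$ ($i,k\in\Pi$, $i\neq k$), $y_{ij}\in\{0,1\}$ ($i\in\Pi\setminus\{0\}$, $\sigma_j\in S$), $v_{ik}\in\mathbb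 Z_{\ge0}$ ($i\in\Pi$, $k\in\Pi\setminus\{0\}$, $i\ne k$). Here $x_{ik}=1$ means the vehicle drives from $i$ to $k$ (and parks at $k$ if $k\ne0$), $y_{ij}=1$ means $\sigma_j$ is served on foot from the vehicle parked at $i$, and $v_{ik}$ is the flow of packages from $i$ to $k$. An optimal solution is an optimal solution of this program. *)

theory Defs
  imports Complex_Main "HOL-Combinatorics.Multiset_Permutations"
begin

text \<open>
  Instances of the Capacitated Delivery Problem with Parking. Customers, parking locations and
  the depot live in one type, since a parking location may itself be a customer; \<open>sites\<close> is the
  set \<open>\<Pi>\<close> and includes the depot. A capacity of \<open>None\<close> means that this kind of restriction is
  not imposed.
\<close>

record 'a cdpp =
  customers :: "'a set"
  sites :: "'a set"
  depot :: 'a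
  search_time :: "'a \<Rightarrow> real"
  drive_time :: "'a \<Rightarrow> 'a \<Rightarrow> real"
  walk_time :: "'a \<Rightarrow> 'a \<Rightarrow> real"
  load_time :: "'a set \<Rightarrow> real"
  weight :: "'a \<Rightarrow> real"
  volume :: "'a \<Rightarrow> real"
  max_packages :: "nat option"
  max_weight :: "real option"
  max_volume :: "real option"

definition parkings :: "'a cdpp \<Rightarrow> 'a set" where
  "parkings I = sites I - {depot I}"

definition within_capacity :: "'a cdpp \<Rightarrow> 'a set \<Rightarrow> bool" where
  "within_capacity I \<sigma> \<longleftrightarrow>
     (\<forall>q. max_packages I = Some q \<longrightarrow> card \<sigma> \<le> q) \<and>
     (\<forall>\<Psi>. max_weight I = Some \<Psi> \<longrightarrow> (\<Sum>i\<in>\<sigma>. weight I i) \<le> \<Psi>) \<and>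
     (\<forall>V. max_volume I = Some V \<longrightarrow> (\<Sum>i\<in>\<sigma>. volume I i) \<le> V)"

definition service_sets :: "'a cdpp \<Rightarrow> 'a set set" where
  "service_sets I = {\<sigma>. \<sigma> \<subseteq> customers I \<and> \<sigma> \<noteq> {} \<and> within_capacity I \<sigma>}"

definition service_sets_of :: "'a cdpp \<Rightarrow> 'a \<Rightarrow> 'a set set" where
  "service_sets_of I i = {\<sigma> \<in> service_sets I. i \<in> \<sigma>}"

text \<open>Travel times need not be symmetric.\<close>

definition travel_times_on :: "'a set \<Rightarrow> ('a \<Rightarrow> 'a \<Rightarrow> real) \<Rightarrow> bool" where
  "travel_times_on A T \<longleftrightarrow>
     (\<forall>i\<in>A. \<forall>k\<in>A. 0 \<le> T i k) \<and>
     (\<forall>i\<in>A. T i i = 0) \<and>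
     (\<forall>i\<in>A. \<forall>j\<in>A. \<forall>k\<in>A. T i k \<le> T i j + T j k)"

definition cdpp_instance :: "'a cdpp \<Rightarrow> bool" where
  "cdpp_instance I \<longleftrightarrow>
     finite (customers I) \<and> customers I \<noteq> {} \<and>
     finite (sites I) \<and> depot I \<in> sites I \<and> depot I \<notin> customers I \<and> parkings I \<noteq> {} \<and>
     (\<forall>i\<in>parkings I. 0 \<le> search_time I i) \<and>
     (\<forall>i\<in>customers I. 0 \<le> weight I i \<and> 0 \<le> volume I i) \<and>
     (max_packages I \<noteq> None \<or> max_weight I \<noteq> None \<or> max_volume I \<noteq> None) \<and>
     (\<forall>i\<in>customers I. within_capacity I {i}) \<and>
     travel_times_on (sites I) (drive_time I) \<and>
     travel_times_on (customers I \<union> parkings I) (walk_time I)"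

text \<open>The times \<open>d\<^sub>i\<^sub>k\<close>, including the search for parking at \<open>k\<close>; only used for \<open>i \<noteq> k\<close>.\<close>

definition drive_park_time :: "'a cdpp \<Rightarrow> 'a \<Rightarrow> 'a \<Rightarrow> real" where
  "drive_park_time I i k =
     (if k = depot I then drive_time I i k else drive_time I i k + search_time I k)"

fun path_length :: "('a \<Rightarrow> 'a \<Rightarrow> real) \<Rightarrow> 'a list \<Rightarrow> real" where
  "path_length T (a # b # cs) = T a b + path_length T (b # cs)"
| "path_length T _ = 0"

text \<open>The times \<open>w\<^sub>i\<^sub>j\<close>: shortest closed walk from \<open>i\<close> over all orderings of \<open>\<sigma>\<close>.\<close>

definition service_walk_time :: "'a cdpp \<Rightarrow> 'a \<Rightarrow> 'a set \<Rightarrow> real" where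
  "service_walk_time I i \<sigma> =
     Min ((\<lambda>cs. path_length (walk_time I) (i # cs @ [i])) ` permutations_of_set \<sigma>)"

text \<open>
  The integer program. The decision variables are total functions, of which only the values at
  the index pairs of the program are constrained and enter the objective (so \<open>x i i\<close>, for
  instance, plays no role). They are integer-valued, so that the difference in the flow
  conservation constraint is not truncated.
\<close>

definition cdpp_cost ::
  "'a cdpp \<Rightarrow> ('a \<Rightarrow> 'a \<Rightarrow> int) \<Rightarrow> ('a \<Rightarrow> 'a set \<Rightarrow> int) \<Rightarrow> real" where
  "cdpp_cost I x y =
     (\<Sum>i\<in>sites I. \<Sum>k\<in>sites I - {i}. of_int (x i k) * drive_park_time I i k) +
     (\<Sum>i\<in>parkings I. \<Sum>\<sigma>\<in>service_sets I.
        of_int (y i \<sigma>) * (service_walk_time I i \<sigma> + load_time I \<sigma>))"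

definition cdpp_feasible ::
  "'a cdpp \<Rightarrow> ('a \<Rightarrow> 'a \<Rightarrow> int) \<Rightarrow> ('a \<Rightarrow> 'a set \<Rightarrow> int) \<Rightarrow> ('a \<Rightarrow> 'a \<Rightarrow> int) \<Rightarrow> bool" where
  "cdpp_feasible I x y v \<longleftrightarrow>
     (\<Sum>i\<in>parkings I. x (depot I) i) = 1 \<and> (\<Sum>i\<in>parkings I. x i (depot I)) = 1 \<and>
     (\<forall>i\<in>customers I. (\<Sum>k\<in>parkings I. \<Sum>\<sigma>\<in>service_sets_of I i. y k \<sigma>) = 1) \<and>
     (\<forall>i\<in>parkings I. (\<Sum>k\<in>sites I - {i}. x k i) = (\<Sum>k\<in>sites I - {i}. x i k)) \<and>
     (\<forall>i\<in>parkings I. \<forall>\<sigma>\<in>service_sets I. y i \<sigma> \<le> (\<Sum>k\<in>sites I - {i}. x k i)) \<and>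
     (\<Sum>i\<in>parkings I. v (depot I) i) = int (card (customers I)) \<and>
     (\<forall>i\<in>sites I. \<forall>k\<in>parkings I. i \<noteq> k \<longrightarrow> v i k \<le> int (card (customers I)) * x i k) \<and>
     (\<forall>i\<in>parkings I.
        (\<Sum>k\<in>sites I - {i}. v k i) - (\<Sum>k\<in>sites I - {depot I, i}. v i k) =
        (\<Sum>\<sigma>\<in>service_sets I. int (card \<sigma>) * y i \<sigma>)) \<and>
     (\<forall>i\<in>sites I. \<forall>k\<in>sites I. i \<noteq> k \<longrightarrow> x i k \<in> {0, 1}) \<and>
     (\<forall>i\<in>parkings I. \<forall>\<sigma>\<in>service_sets I. y i \<sigma> \<in> {0, 1}) \<and>
     (\<forall>i\<in>sites I. \<forall>k\<in>parkings I. i \<noteq> k \<longrightarrow> 0 \<le> v i k)"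

definition cdpp_optimal ::
  "'a cdpp \<Rightarrow> ('a \<Rightarrow> 'a \<Rightarrow> int) \<Rightarrow> ('a \<Rightarrow> 'a set \<Rightarrow> int) \<Rightarrow> ('a \<Rightarrow> 'a \<Rightarrow> int) \<Rightarrow> bool" where
  "cdpp_optimal I x y v \<longleftrightarrow>
     cdpp_feasible I x y v \<and>
     (\<forall>x' y' v'. cdpp_feasible I x' y' v' \<longrightarrow> cdpp_cost I x y \<le> cdpp_cost I x' y')"

end

theory Submission imports Defs
begin

text \<open>
  Suppose that the vehicle parks at a location \<open>i\<close> that is itself a customer, and that from there
  a set \<open>\<sigma>\<close> with \<open>i \<in> \<sigma>\<close> and at least one further customer is served. Serve \<open>{i}\<close> and
  \<open>\<sigma> - {i}\<close> separately instead, both from \<open>i\<close>. The vehicle tour and the flow of packages are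
  unchanged, because \<open>i\<close> still receives \<open>card \<sigma>\<close> packages. The cost does not increase: loading
  times are linear in the number of packages, serving \<open>i\<close> from \<open>i\<close> takes no walking, and skipping
  \<open>i\<close> on the tour through \<open>\<sigma>\<close> does not lengthen it, by the triangle inequality. These facts are
  \<open>split_feasible\<close>, \<open>split_cost\<close> and \<open>service_walk_time_remove\<close>. The two target variables are free
  because every customer is served exactly once (\<open>served_once\<close>).

  Each exchange removes one offending pair \<open>(i, \<sigma>)\<close> and creates none, since \<open>{i}\<close> is a singleton
  and \<open>\<sigma> - {i}\<close> does not contain \<open>i\<close>. So an optimal solution with the fewest offending pairs has
  none. An optimal solution exists because the program is feasible (park once and serve the
  customers one by one) and takes only finitely many costs.
\<close>

section \<open>Walking times\<close>

lemma path_length_Cons: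
  "xs \<noteq> [] \<Longrightarrow> path_length T (a # xs) = T a (hd xs) + path_length T xs"
  by (cases xs) auto

lemma path_length_skip:
  assumes T: "travel_times_on A T"
    and "xs \<noteq> []" "ys \<noteq> []" "set xs \<subseteq> A" "c \<in> A" "set ys \<subseteq> A"
  shows "path_length T (xs @ ys) \<le> path_length T (xs @ c # ys)"
  using assms(2,4)
proof (induction xs)
  case Nil
  then show ?case by simp
next
  case (Cons a xs)
  show ?case
  proof (cases "xs = []")
    case True
    have "hd ys \<in> A" "a \<in> A"
      using assms Cons.prems by auto
    then have "T a (hd ys) \<le> T a c + T c (hd ys)"
      using T \<open>c \<in> A\<close> by (auto simp: travel_times_on_def)
    then show ?thesis
      using True \<open>ys \<noteq> []\<close> by (simp add: path_length_Cons)
  next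
    case False
    then show ?thesis
      using Cons by (simp add: path_length_Cons)
  qed
qed

lemma service_walk_time_le:
  assumes "finite \<sigma>" "cs \<in> permutations_of_set \<sigma>"
  shows "service_walk_time I i \<sigma> \<le> path_length (walk_time I) (i # cs @ [i])"
  unfolding service_walk_time_def using assms by (intro Min_le) auto

lemma service_walk_time_attained:
  assumes "finite \<sigma>"
  obtains cs where "cs \<in> permutations_of_set \<sigma>"
    "service_walk_time I i \<sigma> = path_length (walk_time I) (i # cs @ [i])"
proof -
  have "service_walk_time I i \<sigma>
      \<in> (\<lambda>cs. path_length (walk_time I) (i # cs @ [i])) ` permutations_of_set \<sigma>"
    unfolding service_walk_time_def using assms by (intro Min_in) auto
  then show thesis
    using that by auto
qed

text \<open>
  Dropping \<open>c\<close> from a shortest order of \<open>\<sigma>\<close> gives an order of \<open>\<sigma> - {c}\<close>. Since the walk starts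
  and ends at \<open>i\<close>, every customer is an interior stop, so the triangle inequality applies to it.
\<close>

lemma service_walk_time_remove:
  assumes T: "travel_times_on A (walk_time I)" and "finite \<sigma>" "\<sigma> \<subseteq> A" "i \<in> A" "c \<in> \<sigma>"
  shows "service_walk_time I i (\<sigma> - {c}) \<le> service_walk_time I i \<sigma>"
proof -
  obtain cs where cs: "cs \<in> permutations_of_set \<sigma>"
    and w: "service_walk_time I i \<sigma> = path_length (walk_time I) (i # cs @ [i])"
    by (rule service_walk_time_attained[OF \<open>finite \<sigma>\<close>])
  have set_cs: "set cs = \<sigma>" and dist: "distinct cs"
    using cs by (auto simp: permutations_of_set_def)
  obtain us vs where split: "cs = us @ c # vs"
    using set_cs \<open>c \<in> \<sigma>\<close> by (meson split_list)
  have "us @ vs \<in> permutations_of_set (\<sigma> - {c})"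
    using set_cs dist split by (auto simp: permutations_of_set_def)
  then have "service_walk_time I i (\<sigma> - {c}) \<le> path_length (walk_time I) (i # (us @ vs) @ [i])"
    using \<open>finite \<sigma>\<close> by (intro service_walk_time_le) auto
  also have "\<dots> = path_length (walk_time I) ((i # us) @ (vs @ [i]))"
    by simp
  also have "\<dots> \<le> path_length (walk_time I) ((i # us) @ c # (vs @ [i]))"
    using set_cs split assms by (intro path_length_skip[OF T]) auto
  finally show ?thesis
    using w split by simp
qed

lemma service_walk_time_self:
  assumes "travel_times_on A (walk_time I)" "i \<in> A"
  shows "service_walk_time I i {i} = 0"
  using assms by (simp add: service_walk_time_def travel_times_on_def permutations_of_set_singleton)

section \<open>Service sets\<close>

lemma instance_finite:
  assumes "cdpp_instance I"
  shows "finite (customers I)" "finite (sites I)" "finite (parkings I)" "finite (service_sets I)"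
proof -
  show fin: "finite (customers I)" "finite (sites I)"
    using assms by (simp_all add: cdpp_instance_def)
  then show "finite (parkings I)"
    by (simp add: parkings_def)
  have "service_sets I \<subseteq> Pow (customers I)"
    by (auto simp: service_sets_def)
  then show "finite (service_sets I)"
    using fin by (simp add: finite_subset)
qed

lemma instance_depot:
  assumes "cdpp_instance I"
  shows "depot I \<in> sites I" "depot I \<notin> customers I" "depot I \<notin> parkings I" "parkings I \<noteq> {}"
  using assms by (simp_all add: cdpp_instance_def parkings_def)

lemma finite_service_set:
  assumes "cdpp_instance I" "\<sigma> \<in> service_sets I"
  shows "finite \<sigma>"
  using assms instance_finite(1) by (auto simp: service_sets_def intro: finite_subset)

lemma singleton_service_set:
  "cdpp_instance I \<Longrightarrow> i \<in> customers I \<Longrightarrow> {i} \<in> service_sets I"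
  by (simp add: cdpp_instance_def service_sets_def)

lemma service_sets_downward_closed:
  assumes "cdpp_instance I" "\<sigma> \<in> service_sets I" "\<tau> \<subseteq> \<sigma>" "\<tau> \<noteq> {}"
  shows "\<tau> \<in> service_sets I"
proof -
  have fin: "finite \<sigma>"
    using assms finite_service_set by blast
  have cap: "within_capacity I \<sigma>" and sub: "\<sigma> \<subseteq> customers I"
    using assms by (simp_all add: service_sets_def)
  have "\<forall>i\<in>customers I. 0 \<le> weight I i \<and> 0 \<le> volume I i"
    using assms by (simp add: cdpp_instance_def)
  then have "card \<tau> \<le> card \<sigma>" "sum (weight I) \<tau> \<le> sum (weight I) \<sigma>"
    "sum (volume I) \<tau> \<le> sum (volume I) \<sigma>"
    using fin sub \<open>\<tau> \<subseteq> \<sigma>\<close> by (auto intro!: card_mono sum_mono2)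
  then have "within_capacity I \<tau>"
    using cap unfolding within_capacity_def by (meson order_trans)
  then show ?thesis
    using sub assms by (auto simp: service_sets_def)
qed

section \<open>Existence of an optimal solution\<close>

text \<open>
  Drive to a single parking location \<open>p\<close> and back, and serve the customers from \<open>p\<close> one by one.
\<close>

lemma feasible_exists:
  assumes I: "cdpp_instance I"
  shows "\<exists>x y v. cdpp_feasible I x y v"
proof -
  obtain p where p: "p \<in> parkings I"
    using instance_depot[OF I] by blast
  have fin: "finite (sites I)" "finite (parkings I)" "finite (service_sets I)"
    using instance_finite[OF I] by simp_all
  have depot: "depot I \<in> sites I" "depot I \<notin> parkings I" and p': "p \<in> sites I" "p \<noteq> depot I"
    using instance_depot[OF I] p by (auto simp: parkings_def)
  define x :: "'a \<Rightarrow> 'a \<Rightarrow> int"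
    where "x i k = of_bool (i = depot I \<and> k = p \<or> i = p \<and> k = depot I)" for i k
  define y :: "'a \<Rightarrow> 'a set \<Rightarrow> int"
    where "y i \<sigma> = of_bool (i = p \<and> card \<sigma> = 1)" for i \<sigma>
  define v :: "'a \<Rightarrow> 'a \<Rightarrow> int"
    where "v i k = int (card (customers I)) * of_bool (i = depot I \<and> k = p)" for i k
  have ind: "(\<Sum>k\<in>A. of_bool (k = a \<and> P) :: int) = of_bool (a \<in> A \<and> P)"
    if "finite A" for A :: "'a set" and a P
    using that by (cases P) (simp_all add: of_bool_def sum.delta)
  have depart: "(\<Sum>i\<in>parkings I. x (depot I) i) = 1"
    and return: "(\<Sum>i\<in>parkings I. x i (depot I)) = 1"
    using ind[of "parkings I" p True] fin p p' depot by (simp_all add: x_def)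
  have x_in: "(\<Sum>k\<in>sites I - {i}. x k i) = of_bool (i = p)"
    and x_out: "(\<Sum>k\<in>sites I - {i}. x i k) = of_bool (i = p)" if "i \<in> parkings I" for i
    using ind[of "sites I - {i}" "depot I" "i = p"] that fin depot p'
    by (auto simp: x_def parkings_def)
  have served: "(\<Sum>k\<in>parkings I. \<Sum>\<sigma>\<in>service_sets_of I i. y k \<sigma>) = 1"
    if "i \<in> customers I" for i
  proof -
    have "{\<sigma> \<in> service_sets_of I i. card \<sigma> = 1} = {{i}}"
      using singleton_service_set[OF I that] by (auto simp: service_sets_of_def card_1_singleton_iff)
    moreover have "finite (service_sets_of I i)"
      using fin by (simp add: service_sets_of_def)
    ultimately have 1: "(\<Sum>\<sigma>\<in>service_sets_of I i. of_bool (card \<sigma> = 1) :: int) = 1"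
      by (simp add: sum_of_bool_eq Int_def)
    have "(\<Sum>\<sigma>\<in>service_sets_of I i. y k \<sigma>) = of_bool (k = p)" for k
      using 1 by (cases "k = p") (simp_all add: y_def)
    then show ?thesis
      using ind[of "parkings I" p True] fin p by simp
  qed
  have packages: "(\<Sum>\<sigma>\<in>service_sets I. int (card \<sigma>) * y i \<sigma>)
      = int (card (customers I)) * of_bool (i = p)" for i
  proof -
    have "{\<sigma> \<in> service_sets I. card \<sigma> = 1} = (\<lambda>c. {c}) ` customers I"
      using singleton_service_set[OF I] by (auto simp: service_sets_def card_1_singleton_iff)
    then have "card {\<sigma> \<in> service_sets I. card \<sigma> = 1} = card (customers I)"
      by (simp add: card_image)
    then have "(\<Sum>\<sigma>\<in>service_sets I. of_bool (card \<sigma> = 1) :: int) = int (card (customers I))"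
      using fin by (simp add: sum_of_bool_eq Int_def)
    moreover have "int (card \<sigma>) * y i \<sigma> = of_bool (i = p) * of_bool (card \<sigma> = 1)" for \<sigma>
      by (simp add: y_def)
    ultimately show ?thesis
      by (simp flip: sum_distrib_left)
  qed
  have v_start: "(\<Sum>i\<in>parkings I. v (depot I) i) = int (card (customers I))"
    using ind[of "parkings I" p True] fin p by (simp add: v_def flip: sum_distrib_left)
  have v_in: "(\<Sum>k\<in>sites I - {i}. v k i) = int (card (customers I)) * of_bool (i = p)"
    and v_out: "(\<Sum>k\<in>sites I - {depot I, i}. v i k) = 0" if "i \<in> parkings I" for i
    using ind[of "sites I - {i}" "depot I" "i = p"] that fin depot
    by (auto simp: v_def parkings_def simp flip: sum_distrib_left)
  have "cdpp_feasible I x y v"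
    unfolding cdpp_feasible_def
  proof (intro conjI ballI impI)
    fix i \<sigma>
    assume "i \<in> parkings I"
    then show "y i \<sigma> \<le> (\<Sum>k\<in>sites I - {i}. x k i)"
      by (simp add: x_in y_def)
  qed (use depart return served v_start in
      \<open>simp_all add: packages x_in x_out v_in v_out, simp_all add: x_def y_def v_def\<close>)
  then show ?thesis by blast
qed

lemma leg_binary:
  "cdpp_feasible I x y v \<Longrightarrow> i \<in> sites I \<Longrightarrow> k \<in> sites I \<Longrightarrow> i \<noteq> k \<Longrightarrow> x i k \<in> {0, 1}"
  unfolding cdpp_feasible_def by blast

lemma service_binary:
  "cdpp_feasible I x y v \<Longrightarrow> i \<in> parkings I \<Longrightarrow> \<sigma> \<in> service_sets I \<Longrightarrow> y i \<sigma> \<in> {0, 1}"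
  unfolding cdpp_feasible_def by blast

text \<open>
  A minimum is attained because the binary variables that enter the cost can be encoded by a set
  of driving legs and a set of service decisions, and there are finitely many of these.
\<close>

lemma optimal_exists:
  assumes I: "cdpp_instance I"
  shows "\<exists>x y v. cdpp_optimal I x y v"
proof -
  define costs where "costs = {cdpp_cost I x y | x y v. cdpp_feasible I x y v}"
  define cost_of where "cost_of = (\<lambda>(E, P). cdpp_cost I (\<lambda>i k. of_bool ((i, k) \<in> E))
    (\<lambda>i \<sigma>. of_bool ((i, \<sigma>) \<in> P)))"
  define codes where "codes = Pow (sites I \<times> sites I) \<times> Pow (parkings I \<times> service_sets I)"
  have "costs \<subseteq> cost_of ` codes"
  proof
    fix r assume "r \<in> costs"
    then obtain x y v where feas: "cdpp_feasible I x y v" and r: "r = cdpp_cost I x y"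
      by (auto simp: costs_def)
    define E where "E = {(i, k). i \<in> sites I \<and> k \<in> sites I \<and> x i k = 1}"
    define P where "P = {(i, \<sigma>). i \<in> parkings I \<and> \<sigma> \<in> service_sets I \<and> y i \<sigma> = 1}"
    have "x i k = of_bool ((i, k) \<in> E)" if "i \<in> sites I" "k \<in> sites I - {i}" for i k
      using leg_binary[OF feas, of i k] that by (auto simp: E_def)
    moreover have "y i \<sigma> = of_bool ((i, \<sigma>) \<in> P)"
      if "i \<in> parkings I" "\<sigma> \<in> service_sets I" for i \<sigma>
      using service_binary[OF feas that] that by (auto simp: P_def)
    ultimately have "r = cost_of (E, P)"
      unfolding r cost_of_def cdpp_cost_def prod.case
      by (intro arg_cong2[where f = "(+)"] sum.cong refl) simp_all
    moreover have "(E, P) \<in> codes"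
      by (auto simp: codes_def E_def P_def)
    ultimately show "r \<in> cost_of ` codes"
      by blast
  qed
  moreover have "finite codes"
    using instance_finite[OF I] by (simp add: codes_def)
  ultimately have "finite costs"
    by (meson finite_imageI finite_subset)
  moreover have "costs \<noteq> {}"
    using feasible_exists[OF I] by (auto simp: costs_def)
  ultimately have "Min costs \<in> costs" and least: "\<And>r. r \<in> costs \<Longrightarrow> Min costs \<le> r"
    by auto
  then obtain x y v where "cdpp_feasible I x y v" and "Min costs = cdpp_cost I x y"
    unfolding costs_def by blast
  moreover have "Min costs \<le> cdpp_cost I x' y'" if "cdpp_feasible I x' y' v'" for x' y' v'
    using that by (intro least) (auto simp: costs_def)
  ultimately show ?thesis
    unfolding cdpp_optimal_def by metis
qed

section \<open>Splitting a service set\<close>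

lemma served_once:
  assumes I: "cdpp_instance I" and feas: "cdpp_feasible I x y v"
    and i: "i \<in> parkings I" and c: "c \<in> \<sigma>" "c \<in> \<tau>"
    and \<sigma>: "\<sigma> \<in> service_sets I" "y i \<sigma> = 1" and \<tau>: "\<tau> \<in> service_sets I" "\<tau> \<noteq> \<sigma>"
  shows "y i \<tau> = 0"
proof -
  let ?J = "service_sets_of I c"
  have bin: "y k \<rho> \<in> {0, 1}" if "k \<in> parkings I" "\<rho> \<in> service_sets I" for k \<rho>
    using service_binary[OF feas that] .
  then have nonneg: "0 \<le> y k \<rho>" if "k \<in> parkings I" "\<rho> \<in> service_sets I" for k \<rho>
    using that by fastforce
  have "c \<in> customers I"
    using c \<sigma> by (auto simp: service_sets_def)
  then have total: "(\<Sum>k\<in>parkings I. \<Sum>\<rho>\<in>?J. y k \<rho>) = 1"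
    using feas by (simp add: cdpp_feasible_def)
  have "finite ?J"
    using instance_finite[OF I] by (simp add: service_sets_of_def)
  then have "(\<Sum>\<rho>\<in>{\<sigma>, \<tau>}. y i \<rho>) \<le> (\<Sum>\<rho>\<in>?J. y i \<rho>)"
    using i c \<sigma> \<tau> nonneg by (intro sum_mono2) (auto simp: service_sets_of_def)
  also have "\<dots> \<le> (\<Sum>k\<in>parkings I. \<Sum>\<rho>\<in>?J. y k \<rho>)"
    using i nonneg instance_finite(3)[OF I]
    by (intro member_le_sum sum_nonneg) (auto simp: service_sets_of_def)
  finally have "y i \<tau> \<le> 0"
    using total \<sigma> \<tau> by simp
  then show ?thesis
    using nonneg[OF i \<tau>(1)] by simp
qed

definition split_service ::
  "'a \<Rightarrow> 'a set \<Rightarrow> 'a set \<Rightarrow> ('a \<Rightarrow> 'a set \<Rightarrow> int) \<Rightarrow> 'a \<Rightarrow> 'a set \<Rightarrow> int" where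
  "split_service i \<tau> \<rho> y = y(i := (y i)(\<tau> \<union> \<rho> := 0, \<tau> := 1, \<rho> := 1))"

text \<open>
  A service set \<open>\<tau> \<union> \<rho>\<close> in use at \<open>i\<close> is the disjoint union of two service sets. Serving these
  separately from \<open>i\<close> keeps the solution feasible, and changes the cost by the service times only.
\<close>

locale service_split =
  fixes I :: "'a cdpp" and x y v i \<tau> \<rho>
  assumes I: "cdpp_instance I" and feas: "cdpp_feasible I x y v"
    and i: "i \<in> parkings I"
    and \<tau>: "\<tau> \<in> service_sets I" and \<rho>: "\<rho> \<in> service_sets I" and \<tau>\<rho>: "\<tau> \<union> \<rho> \<in> service_sets I"
    and disj: "\<tau> \<inter> \<rho> = {}" and used: "y i (\<tau> \<union> \<rho>) = 1"
begin

abbreviation "y' \<equiv> split_service i \<tau> \<rho> y"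

lemma nonempty: "\<tau> \<noteq> {}" "\<rho> \<noteq> {}"
  using \<tau> \<rho> by (auto simp: service_sets_def)

lemma distinct_parts: "\<tau> \<noteq> \<rho>" "\<tau> \<union> \<rho> \<noteq> \<tau>" "\<tau> \<union> \<rho> \<noteq> \<rho>"
  using nonempty disj by auto

lemma finite_parts: "finite \<tau>" "finite \<rho>"
  using finite_service_set[OF I] \<tau> \<rho> by simp_all

lemma parts_unused: "y i \<tau> = 0" "y i \<rho> = 0"
proof -
  obtain c d where "c \<in> \<tau>" "d \<in> \<rho>"
    using nonempty by blast
  then show "y i \<tau> = 0" "y i \<rho> = 0"
    using served_once[OF I feas i _ _ \<tau>\<rho> used] \<tau> \<rho> distinct_parts by (metis UnI1 UnI2)+
qed

text \<open>
  All quantities of the program that depend on \<open>y\<close> are weighted sums of this form: the weight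
  counts a customer, counts packages or measures time.
\<close>

lemma weighted_sum_split:
  fixes g :: "'a set \<Rightarrow> 'b::comm_ring_1"
  shows "(\<Sum>\<sigma>\<in>service_sets I. g \<sigma> * of_int (y' i \<sigma>)) =
    (\<Sum>\<sigma>\<in>service_sets I. g \<sigma> * of_int (y i \<sigma>)) - g (\<tau> \<union> \<rho>) + g \<tau> + g \<rho>"
proof -
  let ?D = "{\<tau> \<union> \<rho>, \<tau>, \<rho>}"
  have "(\<Sum>\<sigma>\<in>service_sets I. g \<sigma> * of_int (y' i \<sigma>)) - (\<Sum>\<sigma>\<in>service_sets I. g \<sigma> * of_int (y i \<sigma>))
    = (\<Sum>\<sigma>\<in>service_sets I. g \<sigma> * (of_int (y' i \<sigma>) - of_int (y i \<sigma>)))"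
    by (simp add: sum_subtractf algebra_simps)
  also have "\<dots> = (\<Sum>\<sigma>\<in>?D. g \<sigma> * (of_int (y' i \<sigma>) - of_int (y i \<sigma>)))"
    using instance_finite[OF I] \<tau> \<rho> \<tau>\<rho>
    by (intro sum.mono_neutral_right) (auto simp: split_service_def)
  also have "\<dots> = - g (\<tau> \<union> \<rho>) + g \<tau> + g \<rho>"
    using distinct_parts used parts_unused by (simp add: split_service_def)
  finally show ?thesis
    by (simp add: algebra_simps)
qed

lemma other_parking: "k \<noteq> i \<Longrightarrow> y' k = y k"
  by (simp add: split_service_def)

lemma split_feasible: "cdpp_feasible I x y' v"
proof -
  have "(\<Sum>\<sigma>\<in>service_sets_of I c. y' k \<sigma>) = (\<Sum>\<sigma>\<in>service_sets_of I c. y k \<sigma>)" for c k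
  proof (cases "k = i")
    case True
    have weighted: "(\<Sum>\<sigma>\<in>service_sets_of I c. z \<sigma>)
        = (\<Sum>\<sigma>\<in>service_sets I. of_bool (c \<in> \<sigma>) * of_int (z \<sigma>))" for z :: "'a set \<Rightarrow> int"
      using instance_finite[OF I]
      by (auto simp: service_sets_of_def intro!: sum.mono_neutral_cong_left)
    show ?thesis
      using disj unfolding True weighted weighted_sum_split by auto
  qed (simp add: other_parking)
  moreover have "(\<Sum>\<sigma>\<in>service_sets I. int (card \<sigma>) * y' k \<sigma>)
      = (\<Sum>\<sigma>\<in>service_sets I. int (card \<sigma>) * y k \<sigma>)" for k
    using weighted_sum_split[of "\<lambda>\<sigma>. int (card \<sigma>)"] disj finite_parts
    by (cases "k = i") (simp_all add: other_parking card_Un_disjoint)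
  moreover have "y' k \<sigma> \<le> (\<Sum>l\<in>sites I - {k}. x l k)" and "y' k \<sigma> \<in> {0, 1}"
    if "k \<in> parkings I" "\<sigma> \<in> service_sets I" for k \<sigma>
  proof -
    have old: "y l \<pi> \<le> (\<Sum>h\<in>sites I - {l}. x h l)"
      if "l \<in> parkings I" "\<pi> \<in> service_sets I" for l \<pi>
      using feas that unfolding cdpp_feasible_def by blast
    \<comment> \<open>The vehicle does park at \<open>i\<close>, because \<open>\<tau> \<union> \<rho>\<close> is served from there.\<close>
    have "1 \<le> (\<Sum>h\<in>sites I - {i}. x h i)"
      using old[OF i \<tau>\<rho>] used by simp
    then show "y' k \<sigma> \<le> (\<Sum>l\<in>sites I - {k}. x l k)" and "y' k \<sigma> \<in> {0, 1}"
      using old[OF that] service_binary[OF feas that] by (auto simp: split_service_def)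
  qed
  ultimately show ?thesis
    using feas unfolding cdpp_feasible_def by simp
qed

lemma split_cost:
  defines "t \<equiv> \<lambda>\<sigma>. service_walk_time I i \<sigma> + load_time I \<sigma>"
  shows "cdpp_cost I x y' = cdpp_cost I x y - t (\<tau> \<union> \<rho>) + t \<tau> + t \<rho>"
proof -
  let ?s = "\<lambda>z k. \<Sum>\<sigma>\<in>service_sets I.
    of_int (z k \<sigma>) * (service_walk_time I k \<sigma> + load_time I \<sigma>)"
  have "?s y' i = ?s y i - t (\<tau> \<union> \<rho>) + t \<tau> + t \<rho>"
    using weighted_sum_split[of t] by (simp add: t_def mult.commute)
  moreover have "(\<Sum>k\<in>parkings I - {i}. ?s y' k) = (\<Sum>k\<in>parkings I - {i}. ?s y k)"
    by (intro sum.cong) (auto simp: other_parking)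
  ultimately show ?thesis
    unfolding cdpp_cost_def sum.remove[OF instance_finite(3)[OF I] i, of "?s _"] by simp
qed

end

section \<open>The exchange argument\<close>

text \<open>
  The offending pairs: from a customer's own location that customer is served together with others.
\<close>

definition joint_self_services :: "'a cdpp \<Rightarrow> ('a \<Rightarrow> 'a set \<Rightarrow> int) \<Rightarrow> ('a \<times> 'a set) set" where
  "joint_self_services I y = {(i, \<sigma>). i \<in> sites I \<inter> customers I \<and>
     \<sigma> \<in> service_sets_of I i \<and> 2 \<le> card \<sigma> \<and> y i \<sigma> \<noteq> 0}"

lemma finite_joint_self_services:
  assumes "cdpp_instance I"
  shows "finite (joint_self_services I y)"
proof (rule finite_subset)
  show "joint_self_services I y \<subseteq> customers I \<times> service_sets I"
    by (auto simp: joint_self_services_def service_sets_of_def)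
  show "finite (customers I \<times> service_sets I)"
    using instance_finite[OF assms] by simp
qed

lemma exchange:
  assumes I: "cdpp_instance I"
    and load: "\<forall>\<sigma>\<in>service_sets I. load_time I \<sigma> = f * real (card \<sigma>)"
    and opt: "cdpp_optimal I x y v" and bad: "(i, \<sigma>) \<in> joint_self_services I y"
  shows "\<exists>y'. cdpp_optimal I x y' v \<and> joint_self_services I y' \<subset> joint_self_services I y"
proof -
  have feas: "cdpp_feasible I x y v"
    using opt by (simp add: cdpp_optimal_def)
  have at_i: "i \<in> parkings I" "i \<in> customers I" "i \<in> \<sigma>" and \<sigma>: "\<sigma> \<in> service_sets I" "2 \<le> card \<sigma>"
    and nz: "y i \<sigma> \<noteq> 0"
    using bad instance_depot[OF I]
    by (auto simp: joint_self_services_def service_sets_of_def parkings_def)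
  have fin: "finite \<sigma>" and sub: "\<sigma> \<subseteq> customers I"
    using \<sigma> finite_service_set[OF I] by (auto simp: service_sets_def)
  have card_rest: "card (\<sigma> - {i}) = card \<sigma> - 1"
    using at_i fin by simp
  then have "\<sigma> - {i} \<noteq> {}"
    using \<sigma> by fastforce
  then have rest: "\<sigma> - {i} \<in> service_sets I"
    by (intro service_sets_downward_closed[OF I \<sigma>(1)]) auto
  have un: "{i} \<union> (\<sigma> - {i}) = \<sigma>"
    using at_i by blast
  have "y i \<sigma> = 1"
    using service_binary[OF feas at_i(1) \<sigma>(1)] nz by simp
  then interpret service_split I x y v i "{i}" "\<sigma> - {i}"
    using I feas at_i \<sigma> rest singleton_service_set[OF I at_i(2)]
    by unfold_locales (simp_all only: un, blast)
  have walk: "travel_times_on (customers I \<union> parkings I) (walk_time I)"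
    using I by (simp add: cdpp_instance_def)
  have "service_walk_time I i (\<sigma> - {i}) \<le> service_walk_time I i \<sigma>"
    using sub at_i(2) by (intro service_walk_time_remove[OF walk fin _ _ at_i(3)]) auto
  moreover have "service_walk_time I i {i} = 0"
    using at_i by (intro service_walk_time_self[OF walk]) auto
  moreover have "load_time I {i} + load_time I (\<sigma> - {i}) = load_time I \<sigma>"
  proof -
    have "real (card \<sigma>) = 1 + real (card (\<sigma> - {i}))"
      using card_rest \<sigma> by linarith
    then show ?thesis
      using load rest \<sigma> singleton_service_set[OF I at_i(2)] by (simp add: distrib_left)
  qed
  ultimately have "cdpp_cost I x y' \<le> cdpp_cost I x y"
    unfolding split_cost un by simp
  then have "cdpp_optimal I x y' v"
    using opt split_feasible by (fastforce simp: cdpp_optimal_def)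
  moreover have "joint_self_services I y' \<subseteq> joint_self_services I y - {(i, \<sigma>)}"
    using \<sigma>(2) at_i(3) unfolding joint_self_services_def split_service_def un
    by (auto simp: service_sets_of_def split: if_splits)
  ultimately show ?thesis
    using bad by blast
qed

theorem corollary4p2:
  fixes I :: "'a cdpp" and f :: real
  assumes "cdpp_instance I"
    and "0 \<le> f"
    and "\<forall>\<sigma>\<in>service_sets I. load_time I \<sigma> = f * real (card \<sigma>)"
  shows "\<exists>x y v. cdpp_optimal I x y v \<and>
           (\<forall>i\<in>sites I \<inter> customers I.
              \<forall>\<sigma>\<in>{\<sigma> \<in> service_sets_of I i. 2 \<le> card \<sigma>}. y i \<sigma> = 0)"
proof -
  obtain x y v where opt: "cdpp_optimal I x y v"
    using optimal_exists[OF assms(1)] by blast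
  \<comment> \<open>The tour and the flow can stay fixed; only \<open>y\<close> is chosen minimal.\<close>
  obtain z where z: "cdpp_optimal I x z v"
    and least: "\<And>y'. cdpp_optimal I x y' v \<Longrightarrow>
      card (joint_self_services I z) \<le> card (joint_self_services I y')"
    using ex_has_least_nat[of "\<lambda>y. cdpp_optimal I x y v" y "\<lambda>y. card (joint_self_services I y)"] opt
    by blast
  have "joint_self_services I z = {}"
  proof (rule ccontr)
    assume "joint_self_services I z \<noteq> {}"
    then obtain y' where "cdpp_optimal I x y' v"
      and "joint_self_services I y' \<subset> joint_self_services I z"
      using exchange[OF assms(1,3) z] by fast
    then show False
      using least psubset_card_mono[OF finite_joint_self_services[OF assms(1)]] by (meson leD)
  qed
  then show ?thesis
    using z unfolding joint_self_services_def by blast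
qed

end
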